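(* There exists a numerical constant $C$ such that for all positive integers $m,n$, $$\mathcal{E}_{2,1}\big(\mathrm{id}:\ \ell_\infty^m\mathbin{\widehat\otimes}\ell_\infty^n\to\ell_\infty^m\mathbin{\check\otimes}\ell_\infty^n\big)\le C\sqrt{1+m+n}\,(1+\ln m+\ln n)^{3/2}.$$
   Context: For finite-dimensional Banach spaces $X,Y$ with unit balls $B_X,B_Y$: $X\mathbin{\check\otimes}Y$ is $X\otimes Y$ with the injective norm $\|T\|_\vee=\sup_{x^*\in B_{X^*},y^*\in B_{Y^*}}|\langle x^*\otimes y^*,T\rangle|$ (the operator norm of $T$ as a map $X^*\to Y$), and $X\mathbin{\widehat\otimes}Y$ is $X\otimes Y$ with the projective norm $\|T\|_\wedge=\inf\{\sum_{k}\|x_k\|_X\|y_k\|_Y:\ T=\sum_{k} x_k\otimes y_k\}$ (finite sums). For symmetric convex bodies $D,E$ the packing number is $M(D,E)=\max\{l:\exists\,y_1,\dots,y_l\in D,\ y_j-y_k\notin E\ \forall j\ne k\}$. For a linear operator $T:X\to Y$ the dyadic entropy numbers are $e_k(T)=\inf\{\epsilon>0: M(T(B_X),\epsilon B_Y)\le2^{k-1}\}$, and $\mathcal{E}_{2,1}(T)=\sum_{k=1}^\infty e_k(T)/\sqrt k$. *)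

theory Defs
  imports
    Complex_Main
    "HOL-Library.Extended_Nat"
    "HOL-Library.Extended_Nonnegative_Real"
    "Jordan_Normal_Form.Matrix"
begin

text \<open>
  A real Banach space of dimension \<open>m\<close> is given in coordinates, as \<^term>\<open>carrier_vec m\<close> with a norm
  \<open>N :: real vec \<Rightarrow> real\<close>.  Linear functionals are identified with their coefficient vectors, so the
  duality pairing is the scalar product.  The tensor product of spaces of dimensions \<open>m\<close> and \<open>n\<close> is
  \<^term>\<open>carrier_mat m n\<close>, the elementary tensor of \<open>x\<close> and \<open>y\<close> having the entries \<open>x\<^sub>i y\<^sub>j\<close>.
\<close>

definition unit_ball :: "'a set \<Rightarrow> ('a \<Rightarrow> real) \<Rightarrow> 'a set" where
  "unit_ball V N = {x \<in> V. N x \<le> 1}"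

definition dual_ball :: "nat \<Rightarrow> (real vec \<Rightarrow> real) \<Rightarrow> real vec set" where
  "dual_ball m N = {f \<in> carrier_vec m. \<forall>x \<in> unit_ball (carrier_vec m) N. \<bar>f \<bullet> x\<bar> \<le> 1}"

definition elem_tensor :: "real vec \<Rightarrow> real vec \<Rightarrow> real mat" where
  "elem_tensor x y = mat (dim_vec x) (dim_vec y) (\<lambda>(i, j). x $ i * y $ j)"

text \<open>
  \<open>f \<bullet> (A *\<^sub>v g)\<close> is the pairing of \<open>f \<otimes> g\<close> with \<open>A\<close>: for an elementary tensor \<open>A = x \<otimes> y\<close> it equals
  \<open>(f \<bullet> x) (g \<bullet> y)\<close>.
\<close>

definition injective_norm ::
    "nat \<Rightarrow> nat \<Rightarrow> (real vec \<Rightarrow> real) \<Rightarrow> (real vec \<Rightarrow> real) \<Rightarrow> real mat \<Rightarrow> real" where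
  "injective_norm m n NX NY A =
     Sup {\<bar>f \<bullet> (A *\<^sub>v g)\<bar> | f g. f \<in> dual_ball m NX \<and> g \<in> dual_ball n NY}"

definition projective_norm ::
    "nat \<Rightarrow> nat \<Rightarrow> (real vec \<Rightarrow> real) \<Rightarrow> (real vec \<Rightarrow> real) \<Rightarrow> real mat \<Rightarrow> real" where
  "projective_norm m n NX NY A =
     Inf {(\<Sum>(x, y) \<leftarrow> ps. NX x * NY y) | ps.
            set ps \<subseteq> carrier_vec m \<times> carrier_vec n \<and>
            A = foldr (\<lambda>(x, y) S. elem_tensor x y + S) ps (0\<^sub>m m n)}"

text \<open>Only meaningful for vectors of positive dimension.\<close>

definition sup_norm_vec :: "real vec \<Rightarrow> real" where
  "sup_norm_vec x = Max ((\<lambda>i. \<bar>x $ i\<bar>) ` {..<dim_vec x})"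

text \<open>
  The supremum is taken in \<^typ>\<open>enat\<close>, so that it is \<open>\<infinity>\<close> if there are arbitrarily large packings;
  otherwise it is the maximum.
\<close>

definition packing_number :: "'a::minus set \<Rightarrow> 'a set \<Rightarrow> enat" where
  "packing_number D E =
     Sup {enat l | l. \<exists>y :: nat \<Rightarrow> 'a. (\<forall>j<l. y j \<in> D) \<and>
                        (\<forall>j<l. \<forall>k<l. j \<noteq> k \<longrightarrow> y j - y k \<notin> E)}"

text \<open>
  Entropy numbers of an operator \<open>T\<close> into a space of matrices, where \<open>BX\<close> and \<open>BY\<close> are the unit balls
  of its domain and codomain; the index \<open>k\<close> starts at \<open>1\<close>.
\<close>

definition entropy_number ::
    "('a \<Rightarrow> real mat) \<Rightarrow> 'a set \<Rightarrow> real mat set \<Rightarrow> nat \<Rightarrow> real" where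
  "entropy_number T BX BY k =
     Inf {\<epsilon>. 0 < \<epsilon> \<and> packing_number (T ` BX) ((\<lambda>y. \<epsilon> \<cdot>\<^sub>m y) ` BY) \<le> enat (2 ^ (k - 1))}"

text \<open>
  The sum over \<open>k \<ge> 1\<close>, shifted to start at \<open>0\<close>.  It is taken in \<^typ>\<open>ennreal\<close>, where a divergent series
  has the value \<open>\<infinity>\<close>.
\<close>

definition entropy_sum_21 :: "('a \<Rightarrow> real mat) \<Rightarrow> 'a set \<Rightarrow> real mat set \<Rightarrow> ennreal" where
  "entropy_sum_21 T BX BY =
     (\<Sum>k. ennreal (entropy_number T BX BY (Suc k) / sqrt (real (Suc k))))"

end

theory Submission
  imports Defs
begin

text \<open>
  In coordinates, the injective unit ball contains the cube of matrices with entries of modulus at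
  most \<open>1\<close>, because the dual of a supremum norm is an \<open>\<ell>\<^sub>1\<close> norm, and the
  projective unit ball lies in the convex hull of the \<open>2\<^bsup>m+n\<^esup>\<close> sign tensors
  \<open>s \<otimes> t\<close> with \<open>s \<in> {-1, 1}\<^sup>m\<close> and
  \<open>t \<in> {-1, 1}\<^sup>n\<close>.  So the task is to bound the entropy, in the maximum norm of
  \<open>m n\<close> coordinates, of a polytope with few vertices.

  For indices that are not too large this is Maurey's empirical method: every point of the hull is
  within \<open>4 \<surd>(ln (2 m n) / r)\<close> of an average of \<open>r\<close> vertices
  (lemma \<open>approximation_by_average\<close>), and there are at most
  \<open>2\<^bsup>(m+n) r\<^esup>\<close> such averages.  Hence, with \<open>P = 1 + ln m + ln n\<close>,
  the entropy number \<open>e\<^sub>k\<close> is of order at most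
  \<open>\<surd>((m + n) P / k)\<close> (lemma \<open>entropy_number_le_sqrt\<close>).  The average is
  found without probability, by choosing the vertices one after the other so as to control an
  exponential potential of the accumulated error.

  For large indices a grid on the cube shows that \<open>e\<^sub>k\<close> decays exponentially in
  \<open>k / (m n)\<close>; a quadratic bound \<open>(m n / k)\<^sup>2\<close> is all that is extracted
  from it (lemma \<open>entropy_number_le_inverse_square\<close>).

  In the sum of \<open>e\<^sub>k / \<surd>k\<close> the first bound gives
  \<open>\<surd>((m + n) P)\<close> times a harmonic sum.  Stopping at
  \<open>k = (m n)\<^sup>2\<close> makes that harmonic sum at most \<open>2 P\<close>, which produces
  the exponent \<open>3 / 2\<close>, while the tail, estimated with the second bound, is bounded by an
  absolute constant.
\<close>

section \<open>Packing numbers and entropy numbers\<close>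

text \<open>
  All packing numbers are bounded by the pigeonhole principle: if points with equal codes differ by
  an element of \<open>E\<close>, then the points of a packing have distinct codes.
\<close>

lemma packing_number_le_card:
  fixes D :: "'a::minus set"
  assumes "finite S" and "h ` D \<subseteq> S"
    and "\<And>y z. y \<in> D \<Longrightarrow> z \<in> D \<Longrightarrow> h y = h z \<Longrightarrow> y - z \<in> E"
  shows "packing_number D E \<le> enat (card S)"
  unfolding packing_number_def
proof (rule Sup_least, clarify)
  fix l and y :: "nat \<Rightarrow> 'a"
  assume D: "\<forall>j<l. y j \<in> D" and sep: "\<forall>j<l. \<forall>k<l. j \<noteq> k \<longrightarrow> y j - y k \<notin> E"
  have "inj_on (h \<circ> y) {..<l}"
  proof (rule inj_onI, rule ccontr)
    fix j k assume "j \<in> {..<l}" "k \<in> {..<l}" "(h \<circ> y) j = (h \<circ> y) k" "j \<noteq> k"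
    then show False using D sep assms(3)[of "y j" "y k"] by simp
  qed
  moreover have "(h \<circ> y) ` {..<l} \<subseteq> S"
    using D assms(2) by auto
  ultimately have "card {..<l} \<le> card S"
    using assms(1) card_inj_on_le by blast
  then show "enat l \<le> enat (card S)" by simp
qed

lemma entropy_number_le:
  assumes "0 < \<epsilon>" and "packing_number (T ` BX) ((\<lambda>y. \<epsilon> \<cdot>\<^sub>m y) ` BY) \<le> enat (2 ^ (k - 1))"
  shows "entropy_number T BX BY k \<le> \<epsilon>"
  unfolding entropy_number_def
  by (rule cInf_lower) (use assms in \<open>auto intro!: bdd_belowI[of _ 0]\<close>)

section \<open>The two unit balls\<close>

definition projective_ball :: "nat \<Rightarrow> nat \<Rightarrow> real mat set" where
  "projective_ball m n =
     unit_ball (carrier_mat m n) (projective_norm m n sup_norm_vec sup_norm_vec)"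

definition injective_ball :: "nat \<Rightarrow> nat \<Rightarrow> real mat set" where
  "injective_ball m n =
     unit_ball (carrier_mat m n) (injective_norm m n sup_norm_vec sup_norm_vec)"

definition sign_vector :: "nat set \<Rightarrow> nat \<Rightarrow> real" where
  "sign_vector S i = (if i \<in> S then 1 else - 1)"

lemma abs_sign_vector [simp]: "\<bar>sign_vector S i\<bar> = 1"
  by (simp add: sign_vector_def)

lemma abs_le_sup_norm_vec: "i < dim_vec x \<Longrightarrow> \<bar>x $ i\<bar> \<le> sup_norm_vec x"
  unfolding sup_norm_vec_def by (rule Max_ge) auto

lemma sum_abs_eq_sign: "\<exists>S \<subseteq> {..<m}. (\<Sum>i<m. \<bar>c i\<bar>) = (\<Sum>i<m. sign_vector S i * c i)"
  by (rule exI[of _ "{i. i < m \<and> 0 \<le> c i}"]) (auto simp: sign_vector_def intro!: sum.cong)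

text \<open>The bound follows by testing a functional against the vector of its own signs.\<close>

lemma dual_ball_sup_norm_vec:
  assumes "f \<in> dual_ball m sup_norm_vec" and "0 < m"
  shows "(\<Sum>i<m. \<bar>f $ i\<bar>) \<le> 1"
proof -
  have f: "f \<in> carrier_vec m" using assms by (simp add: dual_ball_def)
  obtain S where S: "(\<Sum>i<m. \<bar>f $ i\<bar>) = (\<Sum>i<m. sign_vector S i * f $ i)"
    using sum_abs_eq_sign by blast
  define x where "x = vec m (sign_vector S)"
  have "sup_norm_vec x \<le> 1"
    unfolding sup_norm_vec_def x_def using assms(2) by (subst Max_le_iff) auto
  then have "x \<in> unit_ball (carrier_vec m) sup_norm_vec"
    by (simp add: unit_ball_def x_def)
  then have "\<bar>f \<bullet> x\<bar> \<le> 1" using assms(1) by (simp add: dual_ball_def)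
  moreover have "f \<bullet> x = (\<Sum>i<m. sign_vector S i * f $ i)"
    unfolding scalar_prod_def x_def
    by (auto simp: atLeast0LessThan mult.commute intro!: sum.cong)
  ultimately show ?thesis using S by linarith
qed

lemma injective_norm_le:
  assumes A: "A \<in> carrier_mat m n" and "0 < m" "0 < n"
    and bound: "\<And>i j. i < m \<Longrightarrow> j < n \<Longrightarrow> \<bar>A $$ (i, j)\<bar> \<le> c"
  shows "injective_norm m n sup_norm_vec sup_norm_vec A \<le> c"
  unfolding injective_norm_def
proof (rule cSup_least)
  have "0\<^sub>v m \<in> dual_ball m sup_norm_vec" "0\<^sub>v n \<in> dual_ball n sup_norm_vec"
    by (auto simp: dual_ball_def unit_ball_def)
  then show "{\<bar>f \<bullet> (A *\<^sub>v g)\<bar> |f g. f \<in> dual_ball m sup_norm_vec \<and> g \<in> dual_ball n sup_norm_vec} \<noteq> {}"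
    by blast
next
  fix z
  assume "z \<in> {\<bar>f \<bullet> (A *\<^sub>v g)\<bar> |f g. f \<in> dual_ball m sup_norm_vec \<and> g \<in> dual_ball n sup_norm_vec}"
  then obtain f g where z: "z = \<bar>f \<bullet> (A *\<^sub>v g)\<bar>"
    and f: "f \<in> dual_ball m sup_norm_vec" and g: "g \<in> dual_ball n sup_norm_vec" by blast
  have c: "0 \<le> c" using bound[of 0 0] assms(2,3) by linarith
  have fc: "f \<in> carrier_vec m" and gc: "g \<in> carrier_vec n"
    using f g by (auto simp: dual_ball_def)
  have row: "\<bar>(A *\<^sub>v g) $ i\<bar> \<le> c" if i: "i < m" for i
  proof -
    have "(A *\<^sub>v g) $ i = (\<Sum>j<n. A $$ (i, j) * g $ j)"
      using A gc i by (auto simp: scalar_prod_def atLeast0LessThan intro!: sum.cong)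
    also have "\<bar>\<dots>\<bar> \<le> (\<Sum>j<n. c * \<bar>g $ j\<bar>)"
      by (rule order_trans[OF sum_abs])
        (auto simp: abs_mult i intro!: sum_mono mult_right_mono bound)
    also have "\<dots> \<le> c * 1"
      unfolding sum_distrib_left[symmetric]
      using dual_ball_sup_norm_vec[OF g assms(3)] c by (rule mult_left_mono)
    finally show ?thesis by simp
  qed
  have "f \<bullet> (A *\<^sub>v g) = (\<Sum>i<m. f $ i * (A *\<^sub>v g) $ i)"
    using A by (simp add: scalar_prod_def atLeast0LessThan)
  also have "\<bar>\<dots>\<bar> \<le> (\<Sum>i<m. \<bar>f $ i\<bar> * c)"
    by (rule order_trans[OF sum_abs]) (auto simp: abs_mult row intro!: sum_mono mult_left_mono)
  also have "\<dots> \<le> 1 * c"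
    unfolding sum_distrib_right[symmetric]
    using dual_ball_sup_norm_vec[OF f assms(2)] c by (rule mult_right_mono)
  finally show "z \<le> c" using z by simp
qed

lemma scaled_injective_ballI:
  assumes A: "A \<in> carrier_mat m n" and "0 < m" "0 < n" and c: "0 < c"
    and bound: "\<And>i j. i < m \<Longrightarrow> j < n \<Longrightarrow> \<bar>A $$ (i, j)\<bar> \<le> c"
  shows "A \<in> (\<lambda>y. c \<cdot>\<^sub>m y) ` injective_ball m n"
proof (rule image_eqI)
  show "A = c \<cdot>\<^sub>m ((1 / c) \<cdot>\<^sub>m A)"
    using c by (intro eq_matI) auto
  have "injective_norm m n sup_norm_vec sup_norm_vec ((1 / c) \<cdot>\<^sub>m A) \<le> 1"
    using A assms(2,3) c bound
    by (intro injective_norm_le) (auto simp: abs_mult field_simps)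
  then show "(1 / c) \<cdot>\<^sub>m A \<in> injective_ball m n"
    using A by (simp add: injective_ball_def unit_ball_def)
qed

text \<open>
  A bilinear form on a product of two cubes is largest at a pair of vertices: with one argument
  fixed, the form is linear in the other, which may be replaced by the signs of the coefficients.
  The signs are chosen for \<open>x\<close> first and for \<open>y\<close> afterwards; the resulting
  value is a sum of moduli, whence its nonnegativity.
\<close>

lemma rank_one_le_sign_tensor:
  fixes x y :: "nat \<Rightarrow> real"
  assumes x: "\<And>i. i < m \<Longrightarrow> \<bar>x i\<bar> \<le> a" and y: "\<And>j. j < n \<Longrightarrow> \<bar>y j\<bar> \<le> b"
    and a: "0 \<le> a" and b: "0 \<le> b"
  shows "\<exists>S \<subseteq> {..<m}. \<exists>T \<subseteq> {..<n}.
     0 \<le> (\<Sum>i<m. \<Sum>j<n. w i j * (sign_vector S i * sign_vector T j)) \<and>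
     (\<Sum>i<m. \<Sum>j<n. w i j * (x i * y j)) \<le> a * b * (\<Sum>i<m. \<Sum>j<n. w i j * (sign_vector S i * sign_vector T j))"
proof -
  \<comment> \<open>the coefficients of the form in its first argument, the second one being \<open>y\<close>\<close>
  define c where "c i = (\<Sum>j<n. w i j * y j)" for i
  obtain S where S: "S \<subseteq> {..<m}" and cS: "(\<Sum>i<m. \<bar>c i\<bar>) = (\<Sum>i<m. sign_vector S i * c i)"
    using sum_abs_eq_sign by blast
  \<comment> \<open>the coefficients in the second argument, the first one being the signs already found\<close>
  define e where "e j = (\<Sum>i<m. w i j * sign_vector S i)" for j
  obtain T where T: "T \<subseteq> {..<n}" and eT: "(\<Sum>j<n. \<bar>e j\<bar>) = (\<Sum>j<n. sign_vector T j * e j)"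
    using sum_abs_eq_sign by blast
  have eT': "(\<Sum>i<m. \<Sum>j<n. w i j * (sign_vector S i * sign_vector T j)) = (\<Sum>j<n. \<bar>e j\<bar>)"
    unfolding eT unfolding e_def by (subst sum.swap) (simp add: sum_distrib_left mult_ac)
  have "(\<Sum>i<m. \<Sum>j<n. w i j * (x i * y j)) = (\<Sum>i<m. x i * c i)"
    unfolding c_def by (simp add: sum_distrib_left mult_ac)
  also have "\<dots> \<le> (\<Sum>i<m. a * \<bar>c i\<bar>)"
  proof (rule sum_mono)
    fix i assume "i \<in> {..<m}"
    then have "\<bar>x i\<bar> * \<bar>c i\<bar> \<le> a * \<bar>c i\<bar>" by (intro mult_right_mono x) auto
    then show "x i * c i \<le> a * \<bar>c i\<bar>" using abs_ge_self[of "x i * c i"] by (simp add: abs_mult)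
  qed
  also have "\<dots> = a * (\<Sum>j<n. y j * e j)"
  proof -
    have "(\<Sum>i<m. sign_vector S i * c i) = (\<Sum>j<n. y j * e j)"
      unfolding c_def e_def sum_distrib_left by (subst sum.swap) (simp add: mult_ac)
    then show ?thesis unfolding sum_distrib_left[symmetric] cS by simp
  qed
  also have "\<dots> \<le> a * (\<Sum>j<n. b * \<bar>e j\<bar>)"
  proof (rule mult_left_mono[OF sum_mono a])
    fix j assume "j \<in> {..<n}"
    then have "\<bar>y j\<bar> * \<bar>e j\<bar> \<le> b * \<bar>e j\<bar>" by (intro mult_right_mono y) auto
    then show "y j * e j \<le> b * \<bar>e j\<bar>" using abs_ge_self[of "y j * e j"] by (simp add: abs_mult)
  qed
  also have "\<dots> = a * b * (\<Sum>j<n. \<bar>e j\<bar>)"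
    by (simp add: sum_distrib_left mult_ac)
  finally show ?thesis
    using S T unfolding eT'[symmetric]
    by (intro exI[of _ S] exI[of _ T] conjI) (auto simp: eT' sum_nonneg)
qed

lemma tensor_sum_carrier:
  assumes "set ps \<subseteq> carrier_vec m \<times> carrier_vec n"
  shows "foldr (\<lambda>(x, y) S. elem_tensor x y + S) ps (0\<^sub>m m n) \<in> carrier_mat m n"
  using assms by (induction ps) (auto simp: elem_tensor_def)

text \<open>
  Splitting a matrix into its rows gives one representation by elementary tensors.  Without it the
  infimum that defines the projective norm could range over the empty set, where it has no meaning.
\<close>

lemma tensor_representation_exists:
  fixes A :: "real mat"
  assumes A: "A \<in> carrier_mat m n"
  shows "\<exists>ps. set ps \<subseteq> carrier_vec m \<times> carrier_vec n \<and>
            A = foldr (\<lambda>(x, y) S. elem_tensor x y + S) ps (0\<^sub>m m n)"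
proof -
  have entry: "foldr (\<lambda>(x, y) S. elem_tensor x y + S) ps (0\<^sub>m m n) $$ (i, j) =
      (\<Sum>(x, y)\<leftarrow>ps. x $ i * y $ j)"
    if "set ps \<subseteq> carrier_vec m \<times> carrier_vec n" "i < m" "j < n" for ps i j
    using that
  proof (induction ps)
    case (Cons p ps)
    obtain x y where p: "p = (x, y)" by force
    have c: "foldr (\<lambda>(x, y) S. elem_tensor x y + S) ps (0\<^sub>m m n) \<in> carrier_mat m n"
      by (rule tensor_sum_carrier) (use Cons.prems in auto)
    show ?case using Cons c by (auto simp: p elem_tensor_def)
  qed simp
  define ps where "ps = map (\<lambda>k. (unit_vec m k :: real vec, row A k)) [0..<m]"
  have ps: "set ps \<subseteq> carrier_vec m \<times> carrier_vec n"
    using A by (auto simp: ps_def)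
  have "A = foldr (\<lambda>(x, y) S. elem_tensor x y + S) ps (0\<^sub>m m n)"
  proof (rule eq_matI)
    fix i j
    assume "i < dim_row (foldr (\<lambda>(x, y) S. elem_tensor x y + S) ps (0\<^sub>m m n))"
      "j < dim_col (foldr (\<lambda>(x, y) S. elem_tensor x y + S) ps (0\<^sub>m m n))"
    then have i: "i < m" and j: "j < n" using tensor_sum_carrier[OF ps] by auto
    have "(\<Sum>(x, y)\<leftarrow>ps. x $ i * y $ j) = (\<Sum>k = 0..<m. unit_vec m k $ i * row A k $ j)"
      by (simp add: ps_def o_def interv_sum_list_conv_sum_set_nat)
    also have "\<dots> = (\<Sum>k = 0..<m. if k = i then A $$ (i, j) else 0)"
      by (rule sum.cong) (use A i j in auto)
    finally show "A $$ (i, j) = foldr (\<lambda>(x, y) S. elem_tensor x y + S) ps (0\<^sub>m m n) $$ (i, j)"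
      using entry[OF ps i j] i by simp
  qed (use tensor_sum_carrier[OF ps] A in auto)
  then show ?thesis using ps by blast
qed

text \<open>
  This is the inclusion of the projective ball in the convex hull of the sign tensors, in its dual
  form: every half-space that contains the sign tensors contains the ball.  A functional bounded by
  \<open>M\<close> on sign tensors is at most \<open>M \<parallel>x\<parallel> \<parallel>y\<parallel>\<close> on
  \<open>x \<otimes> y\<close>, hence at most \<open>M\<close> times the cost of any representation of
  \<open>A\<close>, and \<open>M\<close> times the infimum of these costs.
\<close>

lemma linear_functional_le_on_projective_ball:
  assumes A: "A \<in> projective_ball m n" and "0 < m" "0 < n"
    and bound: "\<And>S T. S \<subseteq> {..<m} \<Longrightarrow> T \<subseteq> {..<n} \<Longrightarrow>
      (\<Sum>i<m. \<Sum>j<n. w i j * (sign_vector S i * sign_vector T j)) \<le> M"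
  shows "(\<Sum>i<m. \<Sum>j<n. w i j * A $$ (i, j)) \<le> M"
proof -
  let ?\<phi> = "\<lambda>A :: real mat. \<Sum>i<m. \<Sum>j<n. w i j * A $$ (i, j)"
  have Ac: "A \<in> carrier_mat m n" and norm: "projective_norm m n sup_norm_vec sup_norm_vec A \<le> 1"
    using A by (auto simp: projective_ball_def unit_ball_def)
  have M: "0 \<le> M"
  proof -
    \<comment> \<open>only the sign information of the rank-one lemma is wanted, so the vectors may be zero\<close>
    obtain S T where "S \<subseteq> {..<m}" "T \<subseteq> {..<n}"
      "0 \<le> (\<Sum>i<m. \<Sum>j<n. w i j * (sign_vector S i * sign_vector T j))"
      using rank_one_le_sign_tensor[of m "\<lambda>_. 0" 0 n "\<lambda>_. 0" 0 w] by auto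
    with bound show ?thesis using order_trans by blast
  qed
  have rank_one: "(\<Sum>i<m. \<Sum>j<n. w i j * (x $ i * y $ j)) \<le> M * (sup_norm_vec x * sup_norm_vec y)"
    if x: "x \<in> carrier_vec m" and y: "y \<in> carrier_vec n" for x y
  proof -
    have xi: "\<bar>x $ i\<bar> \<le> sup_norm_vec x" if "i < m" for i
      using abs_le_sup_norm_vec x that by auto
    have yj: "\<bar>y $ j\<bar> \<le> sup_norm_vec y" if "j < n" for j
      using abs_le_sup_norm_vec y that by auto
    have nonneg: "0 \<le> sup_norm_vec x" "0 \<le> sup_norm_vec y"
      using xi[OF assms(2)] yj[OF assms(3)] by linarith+
    obtain S T where "S \<subseteq> {..<m}" "T \<subseteq> {..<n}" and
      le: "(\<Sum>i<m. \<Sum>j<n. w i j * (x $ i * y $ j))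
       \<le> sup_norm_vec x * sup_norm_vec y * (\<Sum>i<m. \<Sum>j<n. w i j * (sign_vector S i * sign_vector T j))"
      using rank_one_le_sign_tensor[of m "($) x" "sup_norm_vec x" n "($) y" "sup_norm_vec y" w,
          OF xi yj nonneg] by blast
    then have "(\<Sum>i<m. \<Sum>j<n. w i j * (sign_vector S i * sign_vector T j)) \<le> M"
      using bound by blast
    then have "sup_norm_vec x * sup_norm_vec y * (\<Sum>i<m. \<Sum>j<n. w i j * (sign_vector S i * sign_vector T j))
        \<le> sup_norm_vec x * sup_norm_vec y * M"
      by (intro mult_left_mono) (use nonneg in auto)
    with le show ?thesis by (simp add: mult_ac)
  qed
  have rep: "?\<phi> (foldr (\<lambda>(x, y) S. elem_tensor x y + S) ps (0\<^sub>m m n))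
      \<le> M * (\<Sum>(x, y)\<leftarrow>ps. sup_norm_vec x * sup_norm_vec y)"
    if "set ps \<subseteq> carrier_vec m \<times> carrier_vec n" for ps
    using that
  proof (induction ps)
    case (Cons p ps)
    obtain x y where p: "p = (x, y)" by force
    have x: "x \<in> carrier_vec m" and y: "y \<in> carrier_vec n" using Cons.prems p by auto
    let ?R = "foldr (\<lambda>(x, y) S. elem_tensor x y + S) ps (0\<^sub>m m n)"
    have c: "?R \<in> carrier_mat m n"
      by (rule tensor_sum_carrier) (use Cons.prems in auto)
    have "?\<phi> (elem_tensor x y + ?R) = (\<Sum>i<m. \<Sum>j<n. w i j * (x $ i * y $ j)) + ?\<phi> ?R"
      using c x y by (simp add: elem_tensor_def distrib_left sum.distrib[symmetric])
    then show ?case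
      using rank_one[OF x y] Cons by (simp add: p distrib_left)
  qed simp
  show ?thesis
  proof (cases "M = 0")
    case True
    obtain ps where "set ps \<subseteq> carrier_vec m \<times> carrier_vec n"
      "A = foldr (\<lambda>(x, y) S. elem_tensor x y + S) ps (0\<^sub>m m n)"
      using tensor_representation_exists[OF Ac] by blast
    then show ?thesis using rep[of ps] True by simp
  next
    case False
    then have M0: "0 < M" using M by simp
    have "?\<phi> A / M \<le> projective_norm m n sup_norm_vec sup_norm_vec A"
      unfolding projective_norm_def
    proof (rule cInf_greatest)
      show "{\<Sum>(x, y)\<leftarrow>ps. sup_norm_vec x * sup_norm_vec y |ps.
          set ps \<subseteq> carrier_vec m \<times> carrier_vec n \<and>
          A = foldr (\<lambda>(x, y) S. elem_tensor x y + S) ps (0\<^sub>m m n)} \<noteq> {}"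
        using tensor_representation_exists[OF Ac] by blast
    next
      fix z
      assume "z \<in> {\<Sum>(x, y)\<leftarrow>ps. sup_norm_vec x * sup_norm_vec y |ps.
          set ps \<subseteq> carrier_vec m \<times> carrier_vec n \<and>
          A = foldr (\<lambda>(x, y) S. elem_tensor x y + S) ps (0\<^sub>m m n)}"
      then show "?\<phi> A / M \<le> z"
        using rep M0 by (force simp: field_simps)
    qed
    also note norm
    finally show ?thesis using M0 by simp
  qed
qed

lemma abs_entry_le_on_projective_ball:
  assumes A: "A \<in> projective_ball m n" and "i < m" "j < n"
  shows "\<bar>A $$ (i, j)\<bar> \<le> 1"
proof -
  have single: "(\<Sum>k<m. \<Sum>l<n. (if k = i \<and> l = j then c else 0) * g k l) = c * g i j"
    for c :: real and g
  proof -
    have "(\<Sum>l<n. (if k = i \<and> l = j then c else 0) * g k l) = (if k = i then c * g i j else 0)" for k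
      using assms(3) by (cases "k = i") (auto simp: if_distrib[of "\<lambda>u. u * _"] cong: if_cong)
    then show ?thesis using assms(2) by simp
  qed
  have "c * A $$ (i, j) \<le> \<bar>c\<bar>" for c
  proof -
    have "c * (sign_vector S i * sign_vector T j) \<le> \<bar>c\<bar>" for S T
      by (rule order_trans[OF abs_ge_self]) (simp add: abs_mult)
    then show ?thesis
      using linear_functional_le_on_projective_ball
          [OF A, of "\<lambda>k l. if k = i \<and> l = j then c else 0" "\<bar>c\<bar>"] assms(2,3)
      by (simp add: single)
  qed
  from this[of 1] this[of "-1"] show ?thesis by simp
qed

text \<open>
  The form in which membership in the hull feeds the greedy choice of vertices below: no functional
  is strictly smaller at \<open>A\<close> than at all sign tensors.
\<close>

lemma sign_tensor_below:
  assumes A: "A \<in> projective_ball m n" and "0 < m" "0 < n"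
  shows "\<exists>S \<subseteq> {..<m}. \<exists>T \<subseteq> {..<n}.
    (\<Sum>i<m. \<Sum>j<n. w i j * (sign_vector S i * sign_vector T j)) \<le> (\<Sum>i<m. \<Sum>j<n. w i j * A $$ (i, j))"
proof (rule ccontr)
  let ?\<phi> = "\<lambda>p. \<Sum>i<m. \<Sum>j<n. - w i j * (sign_vector (fst p) i * sign_vector (snd p) j)"
  let ?V = "Pow {..<m} \<times> Pow {..<n}"
  assume none: "\<not> ?thesis"
  have above: "?\<phi> p < (\<Sum>i<m. \<Sum>j<n. - w i j * A $$ (i, j))" if "p \<in> ?V" for p
  proof -
    have "fst p \<subseteq> {..<m}" "snd p \<subseteq> {..<n}" using that by auto
    then have "(\<Sum>i<m. \<Sum>j<n. w i j * A $$ (i, j))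
        < (\<Sum>i<m. \<Sum>j<n. w i j * (sign_vector (fst p) i * sign_vector (snd p) j))"
      using none by (meson not_le)
    then show ?thesis by (simp add: sum_negf)
  qed
  have fin: "finite (?\<phi> ` ?V)" "?\<phi> ` ?V \<noteq> {}" by auto
  have "?\<phi> (S, T) \<le> Max (?\<phi> ` ?V)" if "S \<subseteq> {..<m}" "T \<subseteq> {..<n}" for S T
    by (rule Max_ge[OF fin(1)]) (use that in blast)
  then have "(\<Sum>i<m. \<Sum>j<n. - w i j * A $$ (i, j)) \<le> Max (?\<phi> ` ?V)"
    using linear_functional_le_on_projective_ball[OF assms, of "\<lambda>i j. - w i j"] by simp
  moreover have "Max (?\<phi> ` ?V) < (\<Sum>i<m. \<Sum>j<n. - w i j * A $$ (i, j))"
    using above by (subst Max_less_iff[OF fin]) blast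
  ultimately show False by linarith
qed

section \<open>Approximation by averages of vertices\<close>

lemma exp_le_quadratic:
  fixes y :: real
  assumes "\<bar>y\<bar> \<le> 1"
  shows "exp y \<le> 1 + y + y\<^sup>2"
proof (cases "0 \<le> y")
  case True
  then show ?thesis using assms exp_bound[of y] by simp
next
  case False
  define x where "x = - y"
  have x: "0 < x" "x \<le> 1" using False assms by (auto simp: x_def)
  have "exp (- x) \<le> 1 / (1 + x)"
    using exp_ge_add_one_self[of x] x by (simp add: exp_minus field_simps)
  also have "\<dots> \<le> 1 - x + x\<^sup>2"
  proof -
    have "(1 - x + x\<^sup>2) * (1 + x) = 1 + x ^ 3"
      by (simp add: algebra_simps power2_eq_square power3_eq_cube)
    then show ?thesis using x by (simp add: field_simps)
  qed
  finally show ?thesis by (simp add: x_def)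
qed

text \<open>
  One coordinate of the potential when the accumulated error \<open>s\<close> grows by \<open>t\<close>.
  The increase is split into a quadratic factor, which is harmless for small \<open>lam\<close>, and a
  term linear in \<open>t\<close>, whose sum over all coordinates the next vertex makes nonpositive.
\<close>

lemma exp_potential_step:
  fixes s t lam :: real
  assumes "0 \<le> lam" "lam \<le> 1 / 2" "\<bar>t\<bar> \<le> 2"
  shows "exp (lam * (s + t)) + exp (- (lam * (s + t)))
    \<le> (exp (lam * s) + exp (- (lam * s))) * (1 + 4 * lam\<^sup>2)
      + lam * ((exp (lam * s) - exp (- (lam * s))) * t)"
proof -
  have "\<bar>lam * t\<bar> \<le> 1 / 2 * 2" unfolding abs_mult by (intro mult_mono) (use assms in auto)
  then have small: "\<bar>lam * t\<bar> \<le> 1" by simp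
  have "t\<^sup>2 \<le> 2\<^sup>2" using assms(3) unfolding abs_le_square_iff[symmetric] by simp
  then have sq: "(lam * t)\<^sup>2 \<le> 4 * lam\<^sup>2"
    using mult_left_mono[of "t\<^sup>2" 4 "lam\<^sup>2"] by (simp add: power_mult_distrib)
  have "exp (lam * s) * exp (lam * t) \<le> exp (lam * s) * (1 + lam * t + 4 * lam\<^sup>2)"
    using exp_le_quadratic[OF small] sq by (intro mult_left_mono) auto
  moreover have "exp (- (lam * s)) * exp (- (lam * t)) \<le> exp (- (lam * s)) * (1 - lam * t + 4 * lam\<^sup>2)"
    using exp_le_quadratic[of "- (lam * t)"] small sq by (intro mult_left_mono) auto
  ultimately show ?thesis
    by (simp add: distrib_left exp_add[symmetric] algebra_simps)
qed

text \<open>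
  The method of conditional expectations applied to Maurey's random choice of vertices.  The
  derivative of the potential at the current error is a linear functional; since \<open>a\<close> lies in
  the convex hull of the vertices, some vertex is not above \<open>a\<close> for this functional, and
  choosing it as the next one multiplies the potential by at most
  \<open>1 + 4 lam\<^sup>2\<close>.  The potential starts at \<open>2 card I\<close>.
\<close>

lemma greedy_potential_bound:
  fixes a :: "'i \<Rightarrow> real" and v :: "'c \<Rightarrow> 'i \<Rightarrow> real"
  assumes a: "\<And>i. i \<in> I \<Longrightarrow> \<bar>a i\<bar> \<le> 1"
    and v: "\<And>c i. c \<in> V \<Longrightarrow> i \<in> I \<Longrightarrow> \<bar>v c i\<bar> \<le> 1"
    and hull: "\<And>w. \<exists>c\<in>V. (\<Sum>i\<in>I. w i * v c i) \<le> (\<Sum>i\<in>I. w i * a i)"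
    and lam: "0 \<le> lam" "lam \<le> 1 / 2"
  shows "\<exists>cs. set cs \<subseteq> V \<and> length cs = r \<and>
    (\<Sum>i\<in>I. exp (lam * (\<Sum>c\<leftarrow>cs. v c i - a i)) + exp (- (lam * (\<Sum>c\<leftarrow>cs. v c i - a i))))
      \<le> 2 * real (card I) * (1 + 4 * lam\<^sup>2) ^ r"
proof (induction r)
  case 0
  show ?case by (rule exI[of _ "[]"]) (simp add: mult.commute)
next
  case (Suc r)
  then obtain cs where cs: "set cs \<subseteq> V" "length cs = r" and
    bound: "(\<Sum>i\<in>I. exp (lam * (\<Sum>c\<leftarrow>cs. v c i - a i)) + exp (- (lam * (\<Sum>c\<leftarrow>cs. v c i - a i))))
      \<le> 2 * real (card I) * (1 + 4 * lam\<^sup>2) ^ r" by blast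
  define s where "s i = (\<Sum>c\<leftarrow>cs. v c i - a i)" for i
  \<comment> \<open>up to the factor \<open>lam\<close>, the gradient of the potential\<close>
  define w where "w i = exp (lam * s i) - exp (- (lam * s i))" for i
  obtain c where c: "c \<in> V" and cw: "(\<Sum>i\<in>I. w i * v c i) \<le> (\<Sum>i\<in>I. w i * a i)"
    using hull by blast
  have "(\<Sum>i\<in>I. exp (lam * (s i + (v c i - a i))) + exp (- (lam * (s i + (v c i - a i)))))
    \<le> (\<Sum>i\<in>I. (exp (lam * s i) + exp (- (lam * s i))) * (1 + 4 * lam\<^sup>2)
      + lam * (w i * (v c i - a i)))"
  proof (rule sum_mono)
    fix i assume i: "i \<in> I"
    have "\<bar>v c i - a i\<bar> \<le> 2" using a[OF i] v[OF c i] by linarith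
    from exp_potential_step[OF lam this, of "s i"]
    show "exp (lam * (s i + (v c i - a i))) + exp (- (lam * (s i + (v c i - a i))))
      \<le> (exp (lam * s i) + exp (- (lam * s i))) * (1 + 4 * lam\<^sup>2) + lam * (w i * (v c i - a i))"
      by (simp add: w_def)
  qed
  also have "\<dots> = (\<Sum>i\<in>I. exp (lam * s i) + exp (- (lam * s i))) * (1 + 4 * lam\<^sup>2)
      + lam * ((\<Sum>i\<in>I. w i * v c i) - (\<Sum>i\<in>I. w i * a i))"
    unfolding sum.distrib[of "\<lambda>i. _ i * (1 + 4 * lam\<^sup>2)"] sum_distrib_right[symmetric]
      sum_distrib_left[symmetric] right_diff_distrib sum_subtractf by (rule refl)
  also have "\<dots> \<le> (2 * real (card I) * (1 + 4 * lam\<^sup>2) ^ r) * (1 + 4 * lam\<^sup>2) + lam * 0"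
    using bound cw lam by (intro add_mono mult_right_mono mult_left_mono) (auto simp: s_def)
  finally show ?case
    using c cs by (intro exI[of _ "c # cs"]) (simp add: s_def algebra_simps)
qed

text \<open>
  Maurey's lemma for the maximum norm.  With \<open>L = ln (2 card I)\<close>, the potential bounds each
  accumulated error by \<open>(L + 4 lam\<^sup>2 r) / lam\<close>, which is smallest for
  \<open>lam = \<surd>(L / r) / 2\<close>.  This choice respects \<open>lam \<le> 1 / 2\<close> only if
  \<open>L \<le> r\<close>; for smaller \<open>r\<close> the claimed accuracy exceeds the diameter
  \<open>2\<close> of the cube and any vertices will do.
\<close>

lemma approximation_by_average:
  fixes a :: "'i \<Rightarrow> real" and v :: "'c \<Rightarrow> 'i \<Rightarrow> real"
  assumes "finite I" "I \<noteq> {}"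
    and a: "\<And>i. i \<in> I \<Longrightarrow> \<bar>a i\<bar> \<le> 1"
    and v: "\<And>c i. c \<in> V \<Longrightarrow> i \<in> I \<Longrightarrow> \<bar>v c i\<bar> \<le> 1"
    and hull: "\<And>w. \<exists>c\<in>V. (\<Sum>i\<in>I. w i * v c i) \<le> (\<Sum>i\<in>I. w i * a i)"
    and r: "0 < r"
  shows "\<exists>cs. set cs \<subseteq> V \<and> length cs = r \<and>
    (\<forall>i\<in>I. \<bar>(\<Sum>c\<leftarrow>cs. v c i) / r - a i\<bar> \<le> 4 * sqrt (ln (2 * real (card I)) / r))"
proof -
  define L where "L = ln (2 * real (card I))"
  have card: "1 \<le> real (card I)"
    using assms(1,2) by (simp add: Suc_leI card_gt_0_iff)
  then have L: "0 < L" unfolding L_def by (intro ln_gt_zero) linarith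
  have diff: "(\<Sum>c\<leftarrow>cs. v c i) / r - a i = (\<Sum>c\<leftarrow>cs. v c i - a i) / r" if "length cs = r" for cs i
    using that r by (simp add: sum_list_subtractf sum_list_triv diff_divide_distrib)
  show ?thesis
  proof (cases "L \<le> r")
    case True
    define q where "q = sqrt (L / r)"
    have q: "0 < q" "q \<le> 1" and q2: "q\<^sup>2 = L / r" using L r True by (auto simp: q_def)
    have "\<exists>cs. set cs \<subseteq> V \<and> length cs = r \<and>
      (\<Sum>i\<in>I. exp (q / 2 * (\<Sum>c\<leftarrow>cs. v c i - a i)) + exp (- (q / 2 * (\<Sum>c\<leftarrow>cs. v c i - a i))))
      \<le> 2 * real (card I) * (1 + 4 * (q / 2)\<^sup>2) ^ r"
      by (rule greedy_potential_bound[OF a v hull]) (use q in auto)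
    then obtain cs where cs: "set cs \<subseteq> V" "length cs = r" and
      bound: "(\<Sum>i\<in>I. exp (q / 2 * (\<Sum>c\<leftarrow>cs. v c i - a i)) + exp (- (q / 2 * (\<Sum>c\<leftarrow>cs. v c i - a i))))
      \<le> 2 * real (card I) * (1 + 4 * (q / 2)\<^sup>2) ^ r"
      by blast
    have "(1 + 4 * (q / 2)\<^sup>2) ^ r \<le> exp (q\<^sup>2) ^ r"
      using exp_ge_add_one_self[of "q\<^sup>2"] by (intro power_mono) (auto simp: power_divide)
    also have "\<dots> = exp L" using q2 r by (simp add: exp_of_nat_mult[symmetric])
    finally have "2 * real (card I) * (1 + 4 * (q / 2)\<^sup>2) ^ r \<le> exp L * exp L"
      using card by (simp add: L_def)
    then have total: "(\<Sum>i\<in>I. exp (q / 2 * (\<Sum>c\<leftarrow>cs. v c i - a i)) + exp (- (q / 2 * (\<Sum>c\<leftarrow>cs. v c i - a i))))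
      \<le> exp (2 * L)" using bound by (simp add: exp_add[symmetric])
    have "\<bar>(\<Sum>c\<leftarrow>cs. v c i - a i) / r\<bar> \<le> 4 * q" if i: "i \<in> I" for i
    proof -
      define s where "s = (\<Sum>c\<leftarrow>cs. v c i - a i)"
      have "exp (q / 2 * s) + exp (- (q / 2 * s)) \<le> exp (2 * L)"
        unfolding s_def
        by (rule order_trans[OF member_le_sum[OF i] total]) (use assms(1) in \<open>auto intro: add_nonneg_nonneg\<close>)
      then have "exp (q / 2 * s) \<le> exp (2 * L)" "exp (- (q / 2 * s)) \<le> exp (2 * L)"
        using exp_ge_zero[of "q / 2 * s"] exp_ge_zero[of "- (q / 2 * s)"] by linarith+
      then have "q * \<bar>s\<bar> \<le> 4 * L" by (auto simp: abs_if)
      also have "\<dots> = q * (4 * q * r)" using q2 r by (simp add: power2_eq_square field_simps)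
      finally have "\<bar>s\<bar> \<le> 4 * q * r" using q by simp
      then show ?thesis using r by (simp add: s_def[symmetric] field_simps)
    qed
    then show ?thesis using cs diff by (intro exI[of _ cs]) (auto simp: q_def L_def)
  next
    case False
    obtain c where c: "c \<in> V" using hull by blast
    have "1 \<le> sqrt (L / r)" using False r by simp
    have "\<bar>(\<Sum>c\<leftarrow>replicate r c. v c i) / r - a i\<bar> \<le> 4 * sqrt (L / r)" if "i \<in> I" for i
    proof -
      have "(\<Sum>c\<leftarrow>replicate r c. v c i) / r = v c i"
        using r by (simp add: sum_list_replicate)
      then show ?thesis
        using a[OF that] v[OF c that] \<open>1 \<le> sqrt (L / r)\<close> by linarith
    qed
    then show ?thesis
      using c r unfolding L_def by (intro exI[of _ "replicate r c"]) simp
  qed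
qed

section \<open>Entropy numbers of the identity\<close>

lemma entropy_number_le_by_code:
  assumes "0 < m" "0 < n" "0 < \<epsilon>" "finite S" "card S \<le> 2 ^ k"
    and "h ` projective_ball m n \<subseteq> S"
    and close: "\<And>A B i j. A \<in> projective_ball m n \<Longrightarrow> B \<in> projective_ball m n \<Longrightarrow> h A = h B \<Longrightarrow>
      i < m \<Longrightarrow> j < n \<Longrightarrow> \<bar>A $$ (i, j) - B $$ (i, j)\<bar> \<le> \<epsilon>"
  shows "entropy_number id (projective_ball m n) (injective_ball m n) (Suc k) \<le> \<epsilon>"
proof (rule entropy_number_le[OF assms(3)])
  have "packing_number (projective_ball m n) ((\<lambda>y. \<epsilon> \<cdot>\<^sub>m y) ` injective_ball m n) \<le> enat (card S)"
  proof (rule packing_number_le_card[OF assms(4,6)])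
    fix A B assume AB: "A \<in> projective_ball m n" "B \<in> projective_ball m n" "h A = h B"
    then have c: "A \<in> carrier_mat m n" "B \<in> carrier_mat m n"
      by (auto simp: projective_ball_def unit_ball_def)
    then show "A - B \<in> (\<lambda>y. \<epsilon> \<cdot>\<^sub>m y) ` injective_ball m n"
      using close[OF AB] assms(1-3) by (intro scaled_injective_ballI) auto
  qed
  also have "\<dots> \<le> enat (2 ^ (Suc k - 1))" using assms(5) by simp
  finally show "packing_number (id ` projective_ball m n) ((\<lambda>y. \<epsilon> \<cdot>\<^sub>m y) ` injective_ball m n)
    \<le> enat (2 ^ (Suc k - 1))" by simp
qed

text \<open>
  The code of a matrix is the list of the \<open>r\<close> sign tensors whose average approximates it, a
  sign tensor being a pair of sets.  Two matrices with the same code differ by at most twice the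
  error of approximation.
\<close>

lemma entropy_number_le_average:
  assumes m: "0 < m" and n: "0 < n" and r: "0 < r" and k: "(m + n) * r \<le> k"
  shows "entropy_number id (projective_ball m n) (injective_ball m n) (Suc k)
    \<le> 8 * sqrt (ln (2 * real (m * n)) / r)"
proof -
  define V where "V = Pow {..<m} \<times> Pow {..<n}"
  define v where "v c p = sign_vector (fst c) (fst p) * sign_vector (snd c) (snd p)" for c p
  define I where "I = {..<m} \<times> {..<n}"
  define \<delta> where "\<delta> = 4 * sqrt (ln (2 * real (m * n)) / r)"
  have sum_I: "(\<Sum>i<m. \<Sum>j<n. f i j) = (\<Sum>p\<in>I. f (fst p) (snd p))" for f :: "nat \<Rightarrow> nat \<Rightarrow> real"
    unfolding I_def by (simp add: sum.cartesian_product case_prod_beta)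
  have "1 \<le> real (m * n)" using m n by (simp del: of_nat_mult add: Suc_leI)
  then have "0 < ln (2 * real (m * n))" by (intro ln_gt_zero) linarith
  then have \<delta>: "0 < \<delta>" using r by (simp add: \<delta>_def)
  have "\<exists>cs. set cs \<subseteq> V \<and> length cs = r \<and>
    (\<forall>p\<in>I. \<bar>(\<Sum>c\<leftarrow>cs. v c p) / r - A $$ p\<bar> \<le> \<delta>)" if A: "A \<in> projective_ball m n" for A
  proof -
    have hull: "\<exists>c\<in>V. (\<Sum>p\<in>I. w p * v c p) \<le> (\<Sum>p\<in>I. w p * A $$ p)" for w
    proof -
      obtain S T where "S \<subseteq> {..<m}" "T \<subseteq> {..<n}"
        "(\<Sum>i<m. \<Sum>j<n. w (i, j) * (sign_vector S i * sign_vector T j)) \<le> (\<Sum>i<m. \<Sum>j<n. w (i, j) * A $$ (i, j))"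
        using sign_tensor_below[OF A m n, of "\<lambda>i j. w (i, j)"] by blast
      then show ?thesis by (intro bexI[of _ "(S, T)"]) (auto simp: V_def v_def sum_I)
    qed
    show ?thesis
      using approximation_by_average[of I "\<lambda>p. A $$ p" V v r, OF _ _ _ _ hull r]
        abs_entry_le_on_projective_ball[OF A] m n
      by (auto simp: I_def v_def abs_mult \<delta>_def)
  qed
  then obtain h where h: "\<And>A. A \<in> projective_ball m n \<Longrightarrow> set (h A) \<subseteq> V \<and> length (h A) = r \<and>
    (\<forall>p\<in>I. \<bar>(\<Sum>c\<leftarrow>h A. v c p) / r - A $$ p\<bar> \<le> \<delta>)" by metis
  have finV: "finite V" by (simp add: V_def)
  have cardV: "card V = 2 ^ (m + n)" by (simp add: V_def card_cartesian_product card_Pow power_add)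
  have "entropy_number id (projective_ball m n) (injective_ball m n) (Suc k) \<le> 2 * \<delta>"
  proof (rule entropy_number_le_by_code[OF m n, where h = h and S = "{cs. set cs \<subseteq> V \<and> length cs = r}"])
    show "card {cs. set cs \<subseteq> V \<and> length cs = r} \<le> 2 ^ k"
      unfolding card_lists_length_eq[OF finV] cardV using k by (simp add: power_mult[symmetric])
    fix A B i j
    assume AB: "A \<in> projective_ball m n" "B \<in> projective_ball m n" "h A = h B" and ij: "i < m" "j < n"
    have p: "(i, j) \<in> I" using ij by (simp add: I_def)
    have "\<bar>(\<Sum>c\<leftarrow>h A. v c (i, j)) / r - A $$ (i, j)\<bar> \<le> \<delta>"
      "\<bar>(\<Sum>c\<leftarrow>h A. v c (i, j)) / r - B $$ (i, j)\<bar> \<le> \<delta>"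
      using h[OF AB(1)] h[OF AB(2)] p AB(3) by auto
    then show "\<bar>A $$ (i, j) - B $$ (i, j)\<bar> \<le> 2 * \<delta>" by linarith
  next
    show "h ` projective_ball m n \<subseteq> {cs. set cs \<subseteq> V \<and> length cs = r}"
      using h by blast
  qed (use \<delta> finite_lists_length_eq[OF finV] in auto)
  then show ?thesis by (simp add: \<delta>_def)
qed

lemma entropy_number_le_2:
  assumes "0 < m" "0 < n"
  shows "entropy_number id (projective_ball m n) (injective_ball m n) (Suc k) \<le> 2"
proof (rule entropy_number_le_by_code[OF assms, where h = "\<lambda>_. ()" and S = UNIV])
  fix A B i j assume "A \<in> projective_ball m n" "B \<in> projective_ball m n" "i < m" "j < n"
  then have "\<bar>A $$ (i, j)\<bar> \<le> 1" "\<bar>B $$ (i, j)\<bar> \<le> 1"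
    using abs_entry_le_on_projective_ball by blast+
  then show "\<bar>A $$ (i, j) - B $$ (i, j)\<bar> \<le> 2" by linarith
qed auto

text \<open>
  The code of a matrix records the interval of length \<open>2 / 2\<^sup>s\<close> that contains each of
  its entries.  The endpoint \<open>1\<close> has a cell of its own, so there are
  \<open>2\<^sup>s + 1 \<le> 2\<^bsup>s+1\<^esup>\<close> cells per entry.
\<close>

lemma entropy_number_le_grid:
  assumes m: "0 < m" and n: "0 < n" and k: "m * n * Suc s \<le> k"
  shows "entropy_number id (projective_ball m n) (injective_ball m n) (Suc k) \<le> 2 / 2 ^ s"
proof -
  define I where "I = {..<m} \<times> {..<n}"
  define cell where "cell x = nat \<lfloor>2 ^ s * ((x + 1) / 2)\<rfloor>" for x :: real
  define S where "S = I \<rightarrow>\<^sub>E {..2 ^ s :: nat}"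
  show ?thesis
  proof (rule entropy_number_le_by_code[OF m n, where S = S
        and h = "\<lambda>A. restrict (\<lambda>p. cell (A $$ p)) I"])
    show "finite S" by (auto simp: S_def I_def intro!: finite_PiE)
    have "card S = (2 ^ s + 1) ^ (m * n)"
      by (simp add: S_def I_def card_PiE)
    also have "\<dots> \<le> (2 ^ Suc s) ^ (m * n)" by (rule power_mono) auto
    also have "\<dots> = 2 ^ (m * n * Suc s)" 
      by (simp add: power_mult[symmetric] mult.commute del: power_Suc mult_Suc mult_Suc_right)
    also have "\<dots> \<le> 2 ^ k" using k by (rule power_increasing) simp
    finally show "card S \<le> 2 ^ k" .
    have "cell x \<le> 2 ^ s" if "\<bar>x\<bar> \<le> 1" for x
    proof -
      have "2 ^ s * ((x + 1) / 2) \<le> 2 ^ s * 1" using that by (intro mult_left_mono) auto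
      then have "\<lfloor>2 ^ s * ((x + 1) / 2)\<rfloor> \<le> \<lfloor>of_int (2 ^ s) :: real\<rfloor>" by (intro floor_mono) simp
      then show ?thesis unfolding cell_def floor_of_int by (simp add: nat_le_iff)
    qed
    then show "(\<lambda>A. restrict (\<lambda>p. cell (A $$ p)) I) ` projective_ball m n \<subseteq> S"
      using abs_entry_le_on_projective_ball by (fastforce simp: S_def I_def)
    fix A B i j
    assume AB: "A \<in> projective_ball m n" "B \<in> projective_ball m n"
      "restrict (\<lambda>p. cell (A $$ p)) I = restrict (\<lambda>p. cell (B $$ p)) I" and ij: "i < m" "j < n"
    have cell: "cell (A $$ (i, j)) = cell (B $$ (i, j))"
      using fun_cong[OF AB(3), of "(i, j)"] ij by (simp add: I_def)
    have "\<bar>A $$ (i, j)\<bar> \<le> 1" "\<bar>B $$ (i, j)\<bar> \<le> 1"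
      using abs_entry_le_on_projective_ball AB(1,2) ij by blast+
    then have "0 \<le> 2 ^ s * ((A $$ (i, j) + 1) / 2)" "0 \<le> 2 ^ s * ((B $$ (i, j) + 1) / 2)" by auto
    then have "\<lfloor>2 ^ s * ((A $$ (i, j) + 1) / 2)\<rfloor> = \<lfloor>2 ^ s * ((B $$ (i, j) + 1) / 2)\<rfloor>"
      using cell unfolding cell_def by (simp add: nat_eq_iff)
    then have "\<bar>2 ^ s * ((A $$ (i, j) + 1) / 2) - 2 ^ s * ((B $$ (i, j) + 1) / 2)\<bar> < 1"
      by linarith
    moreover have "2 ^ s * ((A $$ (i, j) + 1) / 2) - 2 ^ s * ((B $$ (i, j) + 1) / 2)
        = 2 ^ s / 2 * (A $$ (i, j) - B $$ (i, j))" by (simp add: field_simps)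
    ultimately have "2 ^ s / 2 * \<bar>A $$ (i, j) - B $$ (i, j)\<bar> < 1" by (simp add: abs_mult)
    then show "\<bar>A $$ (i, j) - B $$ (i, j)\<bar> \<le> 2 / 2 ^ s" by (simp add: field_simps)
  qed auto
qed

text \<open>
  For \<open>k \<ge> m + n\<close> averages of \<open>r = k div (m + n)\<close> sign tensors are used.  For
  smaller \<open>k\<close> the right-hand side is at least \<open>16\<close>, more than the trivial bound
  \<open>2\<close>, so that the estimate can be summed from the first index on.
\<close>

lemma entropy_number_le_sqrt:
  assumes m: "0 < m" and n: "0 < n"
  shows "entropy_number id (projective_ball m n) (injective_ball m n) (Suc k)
    \<le> 16 * sqrt ((1 + ln (real (m * n))) * (real m + real n) / Suc k)"
proof -
  define L where "L = ln (2 * real (m * n))"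
  have d: "1 \<le> real (m * n)" using m n by (simp del: of_nat_mult add: Suc_leI)
  have "L = ln 2 + ln (real (m * n))" unfolding L_def by (intro ln_mult_pos) (use d in linarith)+
  then have L: "L \<le> 1 + ln (real (m * n))" using ln_2_less_1 by linarith
  have P: "1 \<le> 1 + ln (real (m * n))" using ln_ge_zero[OF d] by simp
  show ?thesis
  proof (cases "m + n \<le> k")
    case True
    define r where "r = k div (m + n)"
    have r: "0 < r" using True m by (simp add: r_def div_greater_zero_iff)
    have "k < (m + n) * Suc r"
      unfolding r_def using m by (simp add: dividend_less_times_div)
    then have "Suc k \<le> (m + n) * (2 * r)"
      using r mult_le_mono2[of "Suc r" "2 * r" "m + n"] by linarith
    then have "real (Suc k) \<le> real ((m + n) * (2 * r))" by (rule of_nat_mono)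
    then have "real (Suc k) \<le> (real m + real n) * (2 * real r)" by simp
    then have inv: "1 / real r \<le> 4 * ((real m + real n) / Suc k)"
      using r by (simp add: field_simps)
    have "entropy_number id (projective_ball m n) (injective_ball m n) (Suc k) \<le> 8 * sqrt (L / r)"
      unfolding L_def using m n r by (intro entropy_number_le_average) (auto simp: r_def)
    also have "\<dots> \<le> 8 * sqrt (4 * ((1 + ln (real (m * n))) * (real m + real n) / Suc k))"
    proof -
      have "L / r \<le> (1 + ln (real (m * n))) / r" using L by (simp add: divide_right_mono)
      also have "\<dots> \<le> (1 + ln (real (m * n))) * (4 * ((real m + real n) / Suc k))"
        using mult_left_mono[OF inv, of "1 + ln (real (m * n))"] P by simp
      also have "\<dots> = 4 * ((1 + ln (real (m * n))) * (real m + real n) / Suc k)" by simp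
      finally show ?thesis by simp
    qed
    also have "\<dots> = 16 * sqrt ((1 + ln (real (m * n))) * (real m + real n) / Suc k)"
      unfolding real_sqrt_mult[of 4] by simp
    finally show ?thesis .
  next
    case False
    then have "real (Suc k) \<le> real m + real n" by linarith
    then have "1 \<le> (real m + real n) / Suc k" by simp
    then have "1 \<le> (1 + ln (real (m * n))) * ((real m + real n) / Suc k)"
      using mult_mono[OF P, of 1 "(real m + real n) / Suc k"] P by linarith
    then have "1 \<le> sqrt ((1 + ln (real (m * n))) * (real m + real n) / Suc k)" by simp
    then show ?thesis using entropy_number_le_2[OF m n, of k] by linarith
  qed
qed

lemma Suc_square_le_power: "(Suc q)\<^sup>2 \<le> 4 * 2 ^ q"
proof (induction q)
  case (Suc q)
  show ?case
  proof (cases "q < 2")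
    case True
    then have "q = 0 \<or> q = 1" by auto
    then show ?thesis by (auto simp: power2_eq_square)
  next
    case False
    then have "(Suc (Suc q))\<^sup>2 \<le> 2 * (Suc q)\<^sup>2"
      using mult_le_mono[of 2 q 2 q] by (simp add: power2_eq_square)
    then show ?thesis using Suc by simp
  qed
qed simp

text \<open>
  The grid bound decays like \<open>2\<^bsup>-q\<^esup>\<close> with \<open>q = k div (m n)\<close>.  It is
  weakened to \<open>1 / (q + 1)\<^sup>2\<close> to get a tail that can be summed by telescoping.
\<close>

lemma entropy_number_le_inverse_square:
  assumes m: "0 < m" and n: "0 < n" and k: "m * n \<le> k"
  shows "entropy_number id (projective_ball m n) (injective_ball m n) (Suc k)
    \<le> 16 * (real (m * n))\<^sup>2 / (real (Suc k))\<^sup>2"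
proof -
  define d where "d = m * n"
  define q where "q = k div d"
  have d: "0 < d" using m n by (simp add: d_def)
  have q: "0 < q" using k d by (simp add: q_def d_def div_greater_zero_iff)
  then obtain s where s: "q = Suc s" using gr0_implies_Suc by blast
  have "d * Suc s \<le> k" by (simp add: q_def s[symmetric])
  then have "entropy_number id (projective_ball m n) (injective_ball m n) (Suc k) \<le> 2 / 2 ^ s"
    unfolding d_def by (rule entropy_number_le_grid[OF m n])
  also have "\<dots> = 4 / 2 ^ q" by (simp add: s)
  also have "\<dots> \<le> 16 * (real d)\<^sup>2 / (real (Suc k))\<^sup>2"
  proof -
    have "Suc k \<le> d * Suc q"
      unfolding q_def using dividend_less_times_div[OF d, of k] by simp
    then have "(Suc k)\<^sup>2 \<le> (d * Suc q)\<^sup>2" by (rule power_mono) simp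
    also have "\<dots> \<le> d\<^sup>2 * (4 * 2 ^ q)"
      unfolding power_mult_distrib by (rule mult_le_mono2[OF Suc_square_le_power])
    finally have "real ((Suc k)\<^sup>2) \<le> real (d\<^sup>2 * (4 * 2 ^ q))" by (rule of_nat_mono)
    then have "(real (Suc k))\<^sup>2 \<le> (real d)\<^sup>2 * (4 * 2 ^ q)" by simp
    then show ?thesis by (simp add: field_simps)
  qed
  finally show ?thesis by (simp add: d_def)
qed

section \<open>Summation\<close>

lemma harmonic_sum_le: "0 < N \<Longrightarrow> (\<Sum>k<N. 1 / real (Suc k)) \<le> 1 + ln (real N)"
proof (induction N rule: nat_induct_non_zero)
  case (Suc N)
  have "ln (real N / real (Suc N)) \<le> real N / real (Suc N) - 1"
    using Suc.hyps by (intro ln_le_minus_one) auto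
  also have "\<dots> = - (1 / real (Suc N))" by (simp add: field_simps)
  finally have "1 / real (Suc N) \<le> ln (real (Suc N)) - ln (real N)"
    using Suc.hyps by (simp add: ln_div)
  then show ?case using Suc.IH by simp
qed simp

lemma inverse_square_tail_le:
  assumes "0 < N"
  shows "(\<Sum>k=N..<N + j. 1 / (real (Suc k))\<^sup>2) \<le> 1 / N - 1 / (N + j)"
proof (induction j)
  case (Suc j)
  define x where "x = real (N + j)"
  have x: "0 < x" using assms by (simp add: x_def)
  have "1 / (x + 1)\<^sup>2 \<le> 1 / (x * (x + 1))"
    using x by (intro divide_left_mono) (auto simp: power2_eq_square)
  also have "\<dots> = 1 / x - 1 / (x + 1)" using x by (simp add: field_simps)
  finally show ?case using Suc by (simp add: x_def add_ac)
qed simp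

theorem proposition5p2:
  "\<exists>C::real. \<forall>m n :: nat. 0 < m \<longrightarrow> 0 < n \<longrightarrow>
     entropy_sum_21 id
       (unit_ball (carrier_mat m n) (projective_norm m n sup_norm_vec sup_norm_vec))
       (unit_ball (carrier_mat m n) (injective_norm m n sup_norm_vec sup_norm_vec))
     \<le> ennreal (C * sqrt (1 + real m + real n) * (1 + ln (real m) + ln (real n)) powr (3 / 2))"
proof (intro exI[of _ 48] allI impI)
  fix m n :: nat
  assume m: "0 < m" and n: "0 < n"
  define e where "e k = entropy_number id (projective_ball m n) (injective_ball m n) (Suc k)" for k
  define d where "d = m * n"
  \<comment> \<open>the cut between the two regimes: \<open>ln N\<close> is still of order \<open>P\<close>, and the tail
    \<open>d\<^sup>2 / N\<close> beyond it is constant\<close>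
  define N where "N = d\<^sup>2"
  define P where "P = 1 + ln (real m) + ln (real n)"
  define Q where "Q = sqrt (P * (real m + real n))"
  define b where "b k = (if k < N then 16 * Q * (1 / Suc k) else 16 * (real d)\<^sup>2 * (1 / (real (Suc k))\<^sup>2))" for k
  have d: "0 < d" "d \<le> N" using m n by (auto simp: d_def N_def power2_eq_square)
  have P: "1 \<le> P" "P = 1 + ln (real d)"
    using m n by (auto simp: P_def d_def ln_mult)
  have Q: "0 \<le> Q" using P by (simp add: Q_def)
  have term_le: "e k / sqrt (Suc k) \<le> b k" for k
  proof (cases "k < N")
    case True
    have "e k \<le> 16 * sqrt (P * (real m + real n) / Suc k)"
      using entropy_number_le_sqrt[OF m n, of k] by (simp add: e_def P d_def)
    also have "\<dots> = 16 * Q / sqrt (Suc k)" by (simp add: Q_def real_sqrt_divide)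
    finally have "e k / sqrt (Suc k) \<le> 16 * Q / sqrt (Suc k) / sqrt (Suc k)"
      by (rule divide_right_mono) simp
    also have "\<dots> = b k" using True by (simp add: b_def)
    finally show ?thesis .
  next
    case False
    have "e k \<le> 16 * (real d)\<^sup>2 / (real (Suc k))\<^sup>2"
      using entropy_number_le_inverse_square[OF m n, of k] False d by (simp add: e_def d_def)
    then have "e k / sqrt (Suc k) \<le> 16 * (real d)\<^sup>2 / (real (Suc k))\<^sup>2 / sqrt (Suc k)"
      by (rule divide_right_mono) simp
    also have "\<dots> \<le> 16 * (real d)\<^sup>2 / (real (Suc k))\<^sup>2 / 1"
      by (rule divide_left_mono) auto
    also have "\<dots> = b k" using False by (simp add: b_def)
    finally show ?thesis .
  qed
  have b: "0 \<le> b k" for k using Q by (simp add: b_def)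
  have N: "0 < N" using d by simp
  have partial: "(\<Sum>k<K. b k) \<le> 48 * sqrt (1 + real m + real n) * P powr (3 / 2)" for K
  proof -
    have "(\<Sum>k<K. b k) \<le> (\<Sum>k<N + K. b k)" by (rule sum_mono2) (auto simp: b)
    also have "\<dots> = (\<Sum>k<N. b k) + (\<Sum>k=N..<N + K. b k)"
      using sum.atLeastLessThan_concat[of 0 N "N + K" b] by (simp add: atLeast0LessThan)
    also have "(\<Sum>k<N. b k) = 16 * Q * (\<Sum>k<N. 1 / Suc k)"
      unfolding sum_distrib_left by (rule sum.cong) (auto simp: b_def)
    also have "\<dots> \<le> 16 * Q * (2 * P)"
    proof (rule mult_left_mono)
      have "ln (real N) = 2 * ln (real d)" using d by (simp add: N_def ln_realpow)
      then show "(\<Sum>k<N. 1 / Suc k) \<le> 2 * P" using harmonic_sum_le[OF N] P by simp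
    qed (use Q in simp)
    also have "(\<Sum>k=N..<N + K. b k) = 16 * (real d)\<^sup>2 * (\<Sum>k=N..<N + K. 1 / (real (Suc k))\<^sup>2)"
      unfolding sum_distrib_left by (rule sum.cong) (auto simp: b_def)
    also have "\<dots> \<le> 16 * (real d)\<^sup>2 * (1 / N)"
    proof (rule mult_left_mono)
      have "0 \<le> 1 / (real N + real K)" by simp
      then show "(\<Sum>k=N..<N + K. 1 / (real (Suc k))\<^sup>2) \<le> 1 / N"
        using inverse_square_tail_le[OF N, of K] by linarith
    qed simp
    also have "\<dots> = 16" using d by (simp add: N_def)
    finally have main: "(\<Sum>k<K. b k) \<le> 32 * (Q * P) + 16" by simp
    have powr: "P powr (3 / 2) = sqrt P * P"
      using P powr_add[of P "1 / 2" 1] by (simp add: powr_half_sqrt)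
    have "sqrt (real m + real n) * (sqrt P * P) \<le> sqrt (1 + real m + real n) * (sqrt P * P)"
      using P by (intro mult_right_mono) auto
    then have 1: "Q * P \<le> sqrt (1 + real m + real n) * P powr (3 / 2)"
      by (simp add: Q_def powr real_sqrt_mult mult_ac)
    have "1 * 1 \<le> sqrt (1 + real m + real n) * P powr (3 / 2)"
      using P by (intro mult_mono ge_one_powr_ge_zero) auto
    with main 1 show ?thesis by linarith
  qed
  have "(\<Sum>k. ennreal (e k / sqrt (real (Suc k)))) \<le> ennreal (48 * sqrt (1 + real m + real n) * P powr (3 / 2))"
  proof (rule suminf_le_const)
    show "summable (\<lambda>k. ennreal (e k / sqrt (real (Suc k))))" by simp
    fix K
    have "(\<Sum>k<K. ennreal (e k / sqrt (real (Suc k)))) \<le> (\<Sum>k<K. ennreal (b k))"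
      by (intro sum_mono ennreal_leI term_le)
    also have "\<dots> = ennreal (\<Sum>k<K. b k)" using b by (intro sum_ennreal) auto
    also have "\<dots> \<le> ennreal (48 * sqrt (1 + real m + real n) * P powr (3 / 2))"
      by (rule ennreal_leI[OF partial])
    finally show "(\<Sum>k<K. ennreal (e k / sqrt (real (Suc k))))
      \<le> ennreal (48 * sqrt (1 + real m + real n) * P powr (3 / 2))" .
  qed
  then show "entropy_sum_21 id
       (unit_ball (carrier_mat m n) (projective_norm m n sup_norm_vec sup_norm_vec))
       (unit_ball (carrier_mat m n) (injective_norm m n sup_norm_vec sup_norm_vec))
     \<le> ennreal (48 * sqrt (1 + real m + real n) * (1 + ln (real m) + ln (real n)) powr (3 / 2))"
    by (simp add: entropy_sum_21_def e_def P_def projective_ball_def injective_ball_def)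
qed

end
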